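(* Let $n$ be a positive integer. Then $$rn(C_n \square C_n) = \begin{cases} \frac{n^2-2}{2}(k+2) + 2, & \text{if } n = 2k, \\ \frac{n^2-1}{2}(k+1) + 1, & \text{if } n = 2k+1. \end{cases}$$
   Context: For a positive integer $n$, $C_n$ is the cycle graph with vertex set $\{0,1,\dots,n-1\}$, two distinct vertices $v,w$ being adjacent exactly when $v \equiv w \pm 1 \pmod n$ (so $C_1$ is a single vertex and $C_2$ is a single edge). The Cartesian product $G \square H$ has vertex set $V(G)\times V(H)$, with $(g,h)$ adjacent to $(g',h')$ iff either $g=g'$ and $hh'\in E(H)$, or $h=h'$ and $gg'\in E(G)$. For a connected graph $G$, $d(u,v)$ is the length of a shortest $u$–$v$ path and $\operatorname{diam}(G)$ is the maximum of $d(u,v)$ over all pairs of vertices; $\operatorname{diam}(C_n\square C_n)=2\lfloor n/2\rfloor$. A radio labeling of $G$ is a function $c: V(G)\to \mathbb{Z}_+=\{1,2,\dots\}$ such that $d(u,v)+|c(u)-c(v)| \ge 1+\operatorname{diam}(G)$ for all distinct $u,v\in V(G)$. The span of $c$ is the maximum value of $c$, and the radio number $rn(G)$ is the minimum span over all radio labelings of $G$. *)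

theory Defs
  imports Complex_Main "HOL-Number_Theory.Cong" "Graph_Theory.Pair_Digraph"
begin

text \<open>
  A finite simple graph is a \<^locale>\<open>pair_graph\<close>: each undirected edge is represented by
  its two opposite arcs.
\<close>

definition cycle_graph :: "nat \<Rightarrow> nat pair_pre_digraph" where
  "cycle_graph n =
     \<lparr> pverts = {0..<n},
       parcs = {(v, w). v \<in> {0..<n} \<and> w \<in> {0..<n} \<and> v \<noteq> w \<and>
                  ([int v = int w + 1] (mod int n) \<or> [int v = int w - 1] (mod int n))} \<rparr>"

definition cartesian_product ::
    "'a pair_pre_digraph \<Rightarrow> 'b pair_pre_digraph \<Rightarrow> ('a \<times> 'b) pair_pre_digraph" where
  "cartesian_product G H =
     \<lparr> pverts = pverts G \<times> pverts H,
       parcs = {((g, h), (g', h')).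
                  (g, h) \<in> pverts G \<times> pverts H \<and> (g', h') \<in> pverts G \<times> pverts H \<and>
                  (g = g' \<and> (h, h') \<in> parcs H \<or> h = h' \<and> (g, g') \<in> parcs G)} \<rparr>"

lemma pair_graph_cycle_graph: "pair_graph (cycle_graph n)"
proof
  show "finite (parcs (cycle_graph n))"
    by (rule finite_subset[of _ "{0..<n} \<times> {0..<n}"]) (auto simp: cycle_graph_def)
  have "[w = v - 1] (mod m)" if "[v = w + 1] (mod m)" for v w m :: int
    using cong_diff[OF cong_sym[OF that] cong_refl[of 1]] by simp
  moreover have "[w = v + 1] (mod m)" if "[v = w - 1] (mod m)" for v w m :: int
    using cong_add[OF cong_sym[OF that] cong_refl[of 1]] by simp
  ultimately show "symmetric (with_proj (cycle_graph n))"
    unfolding symmetric_def by (auto simp: cycle_graph_def intro!: symI)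
qed (auto simp: cycle_graph_def)

lemma pair_graph_cartesian_product:
  assumes "pair_graph G" "pair_graph H"
  shows "pair_graph (cartesian_product G H)"
proof -
  interpret G: pair_graph G by fact
  interpret H: pair_graph H by fact
  show ?thesis
  proof
    show "finite (pverts (cartesian_product G H))"
      by (simp add: cartesian_product_def G.pair_finite_verts H.pair_finite_verts)
    show "finite (parcs (cartesian_product G H))"
      by (rule finite_subset[of _ "(pverts G \<times> pverts H) \<times> (pverts G \<times> pverts H)"])
        (auto simp: cartesian_product_def G.pair_finite_verts H.pair_finite_verts)
    have "sym (parcs G)" "sym (parcs H)"
      using G.pair_sym_arcs H.pair_sym_arcs by (simp_all add: symmetric_def)
    then show "symmetric (with_proj (cartesian_product G H))"
      by (auto simp: symmetric_def cartesian_product_def intro!: symI dest: symD)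
    show "fst e \<noteq> snd e" if "e \<in> parcs (cartesian_product G H)" for e
      using that by (auto simp: cartesian_product_def dest: G.pair_no_loops H.pair_no_loops)
  qed (auto simp: cartesian_product_def)
qed

text \<open>
  The remaining notions are meant for finite, nonempty, connected graphs; otherwise
  the \<^term>\<open>Least\<close> and \<^term>\<open>Max\<close> below need not be attained.
\<close>

definition graph_dist :: "'a pair_pre_digraph \<Rightarrow> 'a \<Rightarrow> 'a \<Rightarrow> nat" where
  "graph_dist G u v = (LEAST l. \<exists>p. pre_digraph.apath (with_proj G) u p v \<and> length p = l)"

definition diam :: "'a pair_pre_digraph \<Rightarrow> nat" where
  "diam G = Max {graph_dist G u v | u v. u \<in> pverts G \<and> v \<in> pverts G}"

definition radio_labeling :: "'a pair_pre_digraph \<Rightarrow> ('a \<Rightarrow> nat) \<Rightarrow> bool" where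
  "radio_labeling G c \<longleftrightarrow>
     (\<forall>v \<in> pverts G. 1 \<le> c v) \<and>
     (\<forall>u \<in> pverts G. \<forall>v \<in> pverts G. u \<noteq> v \<longrightarrow>
        int (graph_dist G u v) + \<bar>int (c u) - int (c v)\<bar> \<ge> 1 + int (diam G))"

definition label_span :: "'a pair_pre_digraph \<Rightarrow> ('a \<Rightarrow> nat) \<Rightarrow> nat" where
  "label_span G c = Max (c ` pverts G)"

definition radio_number :: "'a pair_pre_digraph \<Rightarrow> nat" where
  "radio_number G = (LEAST s. \<exists>c. radio_labeling G c \<and> label_span G c = s)"

end

theory Submission
  imports Defs
begin

text \<open>
  Lower bound: the pairwise distances of three points on a cycle sum to at most \<open>n\<close>, hence those of
  three vertices of the torus sum to at most \<open>2 * n\<close>. Adding the three radio conditions forces any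
  three labels to spread over at least \<open>K = k + 2\<close> (\<open>n\<close> even) or \<open>K = k + 1\<close> (\<open>n\<close> odd), so that
  a window of \<open>K\<close> consecutive values contains at most two labels.

  Upper bound: we list the vertices in an order in which each group of three consecutive ones
  has distances almost summing to \<open>2 * n\<close>, and give them labels that increase by exactly \<open>K\<close> every
  two positions. Only positions that differ by at most three impose a condition.
\<close>

section \<open>Graph distance from a potential function\<close>

text \<open>Along any walk to \<open>v\<close> the potential drops by at most one per arc, so it
  bounds the length from below. Conversely, always following an arc that lowers it by one gives a
  walk of exactly that length.\<close>

lemma graph_dist_eqI:
  fixes \<delta> :: "'a \<Rightarrow> nat"
  assumes G: "pair_graph G"
    and u: "u \<in> pverts G" and v: "v \<in> pverts G"
    and zero: "\<And>x. x \<in> pverts G \<Longrightarrow> \<delta> x = 0 \<longleftrightarrow> x = v"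
    and lip: "\<And>x y. (x, y) \<in> parcs G \<Longrightarrow> \<delta> x \<le> Suc (\<delta> y)"
    and desc: "\<And>x. x \<in> pverts G \<Longrightarrow> x \<noteq> v \<Longrightarrow> \<exists>y. (x, y) \<in> parcs G \<and> Suc (\<delta> y) = \<delta> x"
  shows "graph_dist G u v = \<delta> u"
proof -
  interpret pair_graph G by fact
  have lower: "\<delta> x \<le> length p" if "awalk x p v" for x p
    using that
  proof (induction p arbitrary: x)
    case Nil
    then show ?case using zero v by (auto simp: awalk_Nil_iff)
  next
    case (Cons e p)
    then have "e \<in> parcs G" "fst e = x" "awalk (snd e) p v"
      by (auto simp: awalk_Cons_iff)
    then show ?case using Cons.IH[of "snd e"] lip[of x "snd e"] by (cases e) auto
  qed
  \<comment> \<open>The bound on the potentials along the path strengthens the induction: a new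
    first vertex has larger potential, hence is not repeated, and the walk stays a path.\<close>
  have ex: "\<exists>p. apath x p v \<and> length p = \<delta> x \<and> (\<forall>y \<in> set (awalk_verts x p). \<delta> y \<le> \<delta> x)"
    if "x \<in> pverts G" for x
    using that
  proof (induction "\<delta> x" arbitrary: x)
    case 0
    then have "x = v" using zero by auto
    then show ?case using 0 v by (intro exI[of _ "[]"]) (auto simp: apath_Nil_iff)
  next
    case (Suc d)
    then have "x \<noteq> v" using zero[of x] by auto
    then obtain y where y: "(x, y) \<in> parcs G" "Suc (\<delta> y) = \<delta> x" using desc Suc.prems by blast
    then have "y \<in> pverts G" using arc_snd_in_verts[of "(x, y)"] by simp
    with Suc.hyps(1)[of y] Suc.hyps(2) y obtain p where p: "apath y p v" "length p = \<delta> y"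
        "\<forall>z \<in> set (awalk_verts y p). \<delta> z \<le> \<delta> y" by auto
    have "apath x ((x, y) # p) v"
      using p y by (auto simp: apath_Cons_iff)
    moreover have "\<forall>z \<in> set (awalk_verts x ((x, y) # p)). \<delta> z \<le> \<delta> x"
      using p y by (auto)
    ultimately show ?case using p y by (intro exI[of _ "(x, y) # p"]) auto
  qed
  show ?thesis
    unfolding graph_dist_def
    by (rule Least_equality) (use ex[OF u] lower in \<open>auto simp: apath_def\<close>)
qed

section \<open>Distances in the torus\<close>

text \<open>The distance from the residue of \<open>x\<close> to 0 in the cycle of order
  \<open>n\<close>. It takes arbitrary integers, so differences and unreduced coordinates need no
  normalization.\<close>

definition cyc_norm :: "int \<Rightarrow> int \<Rightarrow> int" where
  "cyc_norm n x = min (x mod n) ((- x) mod n)"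

text \<open>The norm is read off from a representative of least absolute value; if
  \<open>2 * \<bar>r\<bar> = n\<close>, both signs of \<open>r\<close> give the same value. Concrete
  norms are evaluated through this rule.\<close>

lemma cyc_norm_eqI:
  assumes "x = r + n * q" "2 * \<bar>r\<bar> \<le> n" "n > 0"
  shows "cyc_norm n x = \<bar>r\<bar>"
proof -
  have "x mod n = r mod n" using assms(1) by simp
  note 1 = this mod_minus_cong[OF this]
  show ?thesis
  proof (cases "r = 0")
    case True
    then show ?thesis using 1 by (simp add: cyc_norm_def)
  next
    case False
    show ?thesis
    proof (cases "r > 0")
      case True
      have "r mod n = r" "(-r) mod n = n - r"
        using True assms by (simp_all add: zmod_zminus1_eq_if)
      then show ?thesis using 1 assms True by (simp add: cyc_norm_def)
    next
      case f: False
      have "(-r) mod n = -r" using f False assms by simp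
      moreover have "r mod n = n + r"
        using f False assms mod_pos_pos_trivial[of "n + r" n] by simp
      ultimately show ?thesis using 1 assms f by (simp add: cyc_norm_def)
    qed
  qed
qed

lemma cyc_norm_repE:
  assumes "n > 0"
  obtains r q where "x = r + n * q" "2 * \<bar>r\<bar> \<le> n" "cyc_norm n x = \<bar>r\<bar>"
proof -
  have d: "x = x mod n + n * (x div n)" "0 \<le> x mod n" "x mod n < n" using assms by auto
  show ?thesis
  proof (cases "2 * (x mod n) \<le> n")
    case True
    then have r: "2 * \<bar>x mod n\<bar> \<le> n" using d by simp
    show ?thesis by (rule that[OF d(1) r cyc_norm_eqI[OF d(1) r assms]])
  next
    case False
    then have r: "2 * \<bar>x mod n - n\<bar> \<le> n" using d by simp
    have e: "x = (x mod n - n) + n * (x div n + 1)" using d(1) by (simp add: algebra_simps)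
    show ?thesis by (rule that[OF e r cyc_norm_eqI[OF e r assms]])
  qed
qed

lemma cyc_norm_small: "n > 0 \<Longrightarrow> 2 * \<bar>r\<bar> \<le> n \<Longrightarrow> cyc_norm n r = \<bar>r\<bar>"
  using cyc_norm_eqI[of r r n 0] by simp

lemma cyc_norm_minus [simp]: "cyc_norm n (- x) = cyc_norm n x"
  by (simp add: cyc_norm_def min.commute)

lemma cyc_norm_cong: "[x = y] (mod n) \<Longrightarrow> cyc_norm n x = cyc_norm n y"
  using cong_minus_minus_iff[of x y n] by (simp add: cyc_norm_def cong_def)

lemma cyc_norm_nonneg: "n > 0 \<Longrightarrow> 0 \<le> cyc_norm n x"
  by (simp add: cyc_norm_def)

lemma cyc_norm_le: "n > 0 \<Longrightarrow> 2 * cyc_norm n x \<le> n"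
  by (rule cyc_norm_repE[of n x]) auto

lemma cyc_norm_eq_0_iff: "n > 0 \<Longrightarrow> cyc_norm n x = 0 \<longleftrightarrow> n dvd x"
  by (simp add: cyc_norm_def min_def mod_eq_0_iff_dvd)

text \<open>For least representatives, \<open>r1 + r2 - r3\<close> is a multiple of \<open>n\<close>
  of absolute value at most \<open>3 * n / 2\<close>, hence 0 or \<open>\<plusminus> n\<close>. If
  it is 0, the sum of norms is twice the largest norm; otherwise \<open>r1\<close>,
  \<open>r2\<close>, \<open>- r3\<close> share a sign and the sum is \<open>n\<close>.\<close>

lemma cyc_norm_triangle_sum:
  assumes n: "n > 0"
  shows "cyc_norm n x + cyc_norm n y + cyc_norm n (x + y) \<le> n"
proof -
  obtain r1 q1 where 1: "x = r1 + n * q1" "2 * \<bar>r1\<bar> \<le> n" "cyc_norm n x = \<bar>r1\<bar>"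
    using cyc_norm_repE[OF n] .
  obtain r2 q2 where 2: "y = r2 + n * q2" "2 * \<bar>r2\<bar> \<le> n" "cyc_norm n y = \<bar>r2\<bar>"
    using cyc_norm_repE[OF n] .
  obtain r3 q3 where 3: "x + y = r3 + n * q3" "2 * \<bar>r3\<bar> \<le> n" "cyc_norm n (x + y) = \<bar>r3\<bar>"
    using cyc_norm_repE[OF n] .
  define q where "q = q3 - q1 - q2"
  have e: "r1 + r2 - r3 = n * q" using 1 2 3 by (simp add: q_def algebra_simps)
  have "q < 2"
  proof (rule ccontr)
    assume "\<not> q < 2"
    then have "n * 2 \<le> n * q" using n by simp
    then show False using e 1 2 3 n by linarith
  qed
  moreover have "q > -2"
  proof (rule ccontr)
    assume "\<not> q > -2"
    then have "n * q \<le> n * (-2)" using n by (intro mult_left_mono) auto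
    then show False using e 1 2 3 n by linarith
  qed
  ultimately have "q = -1 \<or> q = 0 \<or> q = 1" by auto
  then show ?thesis using e 1 2 3 n by auto
qed

lemma cyc_norm_step:
  assumes n: "n > 0" and e: "\<bar>e\<bar> = 1"
  shows "cyc_norm n (x + e) \<le> cyc_norm n x + 1"
proof -
  obtain r q where 1: "x = r + n * q" "2 * \<bar>r\<bar> \<le> n" "cyc_norm n x = \<bar>r\<bar>"
    using cyc_norm_repE[OF n] .
  have re: "\<bar>r + e\<bar> \<le> \<bar>r\<bar> + 1" using abs_triangle_ineq[of r e] e by simp
  show ?thesis
  proof (cases "2 * \<bar>r + e\<bar> \<le> n")
    case True
    have "x + e = (r + e) + n * q" using 1(1) by simp
    then have "cyc_norm n (x + e) = \<bar>r + e\<bar>" using True n by (rule cyc_norm_eqI)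
    \<comment> \<open>In the remaining case \<open>r + e\<close> is no least representative, so
      \<open>\<bar>r\<bar> + 1\<close> already reaches \<open>n / 2\<close>, the bound for every
      norm.\<close>
    then show ?thesis using re 1(3) by simp
  next
    case False
    then have "n \<le> 2 * \<bar>r\<bar> + 2" using re by simp
    then show ?thesis using cyc_norm_le[OF n, of "x + e"] 1(3) by simp
  qed
qed

lemma cyc_norm_descent:
  assumes n: "n > 0" and x: "cyc_norm n x \<noteq> 0"
  obtains e where "\<bar>e\<bar> = 1" "cyc_norm n (x + e) + 1 = cyc_norm n x"
proof -
  obtain r q where 1: "x = r + n * q" "2 * \<bar>r\<bar> \<le> n" "cyc_norm n x = \<bar>r\<bar>"
    using cyc_norm_repE[OF n] .
  have "cyc_norm n (x + (- sgn r)) = \<bar>r - sgn r\<bar>"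
    using 1 x n by (intro cyc_norm_eqI[of _ _ _ q]) (auto simp: sgn_if)
  then show ?thesis using that[of "- sgn r"] 1 x by (auto simp: sgn_if split: if_splits)
qed

section \<open>Distance and diameter of the torus\<close>

definition torus_dist :: "nat \<Rightarrow> nat \<times> nat \<Rightarrow> nat \<times> nat \<Rightarrow> int" where
  "torus_dist n u v = cyc_norm n (int (fst u) - int (fst v)) + cyc_norm n (int (snd u) - int (snd v))"

abbreviation torus :: "nat \<Rightarrow> (nat \<times> nat) pair_pre_digraph" where
  "torus n \<equiv> cartesian_product (cycle_graph n) (cycle_graph n)"

lemma pverts_torus: "pverts (torus n) = {0..<n} \<times> {0..<n}"
  by (simp add: cartesian_product_def cycle_graph_def)

lemma cycle_graph_arcE:
  assumes "(v, w) \<in> parcs (cycle_graph n)"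
  obtains e where "\<bar>e\<bar> = 1" "[int v = int w + e] (mod int n)"
  using assms that[of 1] that[of "-1"] by (auto simp: cycle_graph_def)

lemma cyc_norm_arc_le:
  assumes "(v, w) \<in> parcs (cycle_graph n)"
  shows "cyc_norm n (int v - a) \<le> cyc_norm n (int w - a) + 1"
proof -
  obtain e where e: "\<bar>e\<bar> = 1" "[int v = int w + e] (mod int n)"
    using cycle_graph_arcE[OF assms] .
  have "n > 0" using assms by (auto simp: cycle_graph_def)
  have "[int v - a = int w - a + e] (mod int n)"
    using cong_diff[OF e(2) cong_refl[of a]] by (simp add: algebra_simps)
  then show ?thesis
    using cyc_norm_cong cyc_norm_step[of n e "int w - a"] e(1) \<open>n > 0\<close> by simp
qed

lemma cyc_norm_arc_descent:
  assumes v: "v < n" and z: "cyc_norm n (int v - a) \<noteq> 0"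
  obtains w where "(v, w) \<in> parcs (cycle_graph n)"
    "cyc_norm n (int w - a) + 1 = cyc_norm n (int v - a)"
proof -
  have n: "int n > 0" using v by auto
  obtain e where e: "\<bar>e\<bar> = 1" "cyc_norm n (int v - a + e) + 1 = cyc_norm n (int v - a)"
    using cyc_norm_descent[OF n z] .
  define w where "w = nat ((int v + e) mod int n)"
  have w: "int w = (int v + e) mod int n" using n by (simp add: w_def)
  have cw: "[int w = int v + e] (mod int n)" by (simp add: w cong_def)
  have "[int w - a = int v - a + e] (mod int n)"
    using cong_diff[OF cw cong_refl[of a]] by (simp add: algebra_simps)
  then have r: "cyc_norm n (int w - a) + 1 = cyc_norm n (int v - a)"
    using e(2) cyc_norm_cong by simp
  moreover have "w < n" using w n by (metis of_nat_less_iff pos_mod_bound)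
  moreover have "w \<noteq> v" using r by auto
  moreover have "[int v = int w - e] (mod int n)"
    using cong_diff[OF cong_sym[OF cw] cong_refl[of e]] by (simp add: algebra_simps)
  moreover have "e = 1 \<or> e = -1" using e by auto
  ultimately show ?thesis using v by (intro that[of w]) (auto simp: cycle_graph_def)
qed

text \<open>\<open>torus_dist n x v\<close> serves as the potential: an arc changes one coordinate
  only, and any coordinate with nonzero norm can be moved one step towards \<open>v\<close>.\<close>

lemma graph_dist_torus:
  assumes u: "u \<in> pverts (torus n)" and v: "v \<in> pverts (torus n)"
  shows "int (graph_dist (torus n) u v) = torus_dist n u v"
proof -
  have n: "int n > 0" using u by (auto simp: pverts_torus)
  note nn = cyc_norm_nonneg[OF n]
  have nn2: "torus_dist n x v \<ge> 0" for x using nn by (simp add: torus_dist_def)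
  have "graph_dist (torus n) u v = nat (torus_dist n u v)"
  proof (rule graph_dist_eqI[where \<delta> = "\<lambda>x. nat (torus_dist n x v)"])
    show "pair_graph (torus n)"
      by (intro pair_graph_cartesian_product pair_graph_cycle_graph)
    fix x assume x: "x \<in> pverts (torus n)"
    show "nat (torus_dist n x v) = 0 \<longleftrightarrow> x = v"
    proof
      assume "nat (torus_dist n x v) = 0"
      then have "cyc_norm n (int (fst x) - int (fst v)) = 0" "cyc_norm n (int (snd x) - int (snd v)) = 0"
        using nn[of "int (fst x) - int (fst v)"] nn[of "int (snd x) - int (snd v)"]
        by (auto simp: torus_dist_def)
      then have "[int (fst x) = int (fst v)] (mod int n)" "[int (snd x) = int (snd v)] (mod int n)"
        using n by (auto simp: cyc_norm_eq_0_iff cong_iff_dvd_diff)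
      then have "[fst x = fst v] (mod n)" "[snd x = snd v] (mod n)"
        by (auto simp: cong_int_iff)
      then show "x = v" using x v by (auto simp: pverts_torus cong_def)
    qed (simp add: torus_dist_def cyc_norm_def)
    assume "x \<noteq> v"
    with \<open>(nat (torus_dist n x v) = 0) = (x = v)\<close> have "torus_dist n x v \<noteq> 0" by auto
    then consider "cyc_norm n (int (fst x) - int (fst v)) \<noteq> 0"
      | "cyc_norm n (int (snd x) - int (snd v)) \<noteq> 0"
      unfolding torus_dist_def by fastforce
    then show "\<exists>y. (x, y) \<in> parcs (torus n) \<and> Suc (nat (torus_dist n y v)) = nat (torus_dist n x v)"
    proof cases
      case 1
      have "fst x < n" using x by (auto simp: pverts_torus)
      with 1 obtain w where w: "(fst x, w) \<in> parcs (cycle_graph n)"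
        "cyc_norm n (int w - int (fst v)) + 1 = cyc_norm n (int (fst x) - int (fst v))"
        using cyc_norm_arc_descent by blast
      then have "(x, (w, snd x)) \<in> parcs (torus n)"
        using x by (auto simp: cartesian_product_def cycle_graph_def)
      moreover have "torus_dist n (w, snd x) v + 1 = torus_dist n x v"
        using w by (simp add: torus_dist_def)
      ultimately show ?thesis using nn2[of "(w, snd x)"] by (intro exI[of _ "(w, snd x)"]) auto
    next
      case 2
      have "snd x < n" using x by (auto simp: pverts_torus)
      with 2 obtain w where w: "(snd x, w) \<in> parcs (cycle_graph n)"
        "cyc_norm n (int w - int (snd v)) + 1 = cyc_norm n (int (snd x) - int (snd v))"
        using cyc_norm_arc_descent by blast
      then have "(x, (fst x, w)) \<in> parcs (torus n)"
        using x by (auto simp: cartesian_product_def cycle_graph_def)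
      moreover have "torus_dist n (fst x, w) v + 1 = torus_dist n x v"
        using w by (simp add: torus_dist_def)
      ultimately show ?thesis using nn2[of "(fst x, w)"] by (intro exI[of _ "(fst x, w)"]) auto
    qed
  next
    fix x y assume "(x, y) \<in> parcs (torus n)"
    then have "torus_dist n x v \<le> torus_dist n y v + 1"
      using cyc_norm_arc_le[of "fst x" "fst y" n "int (fst v)"]
        cyc_norm_arc_le[of "snd x" "snd y" n "int (snd v)"]
      by (auto simp: cartesian_product_def torus_dist_def)
    then show "nat (torus_dist n x v) \<le> Suc (nat (torus_dist n y v))" using nn2[of y] by linarith
  qed (use u v in auto)
  then show ?thesis using nn2 by simp
qed

lemma torus_dist_le:
  assumes "n > 0"
  shows "torus_dist n u v \<le> 2 * int (n div 2)"
proof -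
  have le: "cyc_norm n x \<le> int (n div 2)" for x
    using cyc_norm_le[of n x] assms by linarith
  show ?thesis unfolding torus_dist_def mult_2 by (rule add_mono[OF le le])
qed

lemma diam_torus:
  assumes n: "n > 0"
  shows "diam (torus n) = 2 * (n div 2)"
  unfolding diam_def
proof (rule Max_eqI)
  let ?V = "pverts (torus n)"
  have "{graph_dist (torus n) u v |u v. u \<in> ?V \<and> v \<in> ?V} = (\<lambda>(u, v). graph_dist (torus n) u v) ` (?V \<times> ?V)"
    by auto
  then show "finite {graph_dist (torus n) u v |u v. u \<in> ?V \<and> v \<in> ?V}"
    by (simp add: pverts_torus)
  fix y assume "y \<in> {graph_dist (torus n) u v |u v. u \<in> ?V \<and> v \<in> ?V}"
  then obtain u v where "y = graph_dist (torus n) u v" "u \<in> ?V" "v \<in> ?V" by auto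
  then show "y \<le> 2 * (n div 2)"
    using graph_dist_torus[of u n v] torus_dist_le[OF n, of u v] by linarith
next
  let ?V = "pverts (torus n)" and ?u = "(n div 2, n div 2)" and ?v = "(0, 0)"
  have "?u \<in> ?V" "?v \<in> ?V" using n by (auto simp: pverts_torus)
  moreover have "torus_dist n ?u ?v = 2 * int (n div 2)"
    using n by (simp add: torus_dist_def cyc_norm_small)
  ultimately show "2 * (n div 2) \<in> {graph_dist (torus n) u v |u v. u \<in> ?V \<and> v \<in> ?V}"
    using graph_dist_torus[of ?u n ?v] by force
qed

lemma radio_labeling_torus_iff:
  assumes n: "n > 0"
  shows "radio_labeling (torus n) c \<longleftrightarrow>
    (\<forall>v \<in> {0..<n} \<times> {0..<n}. 1 \<le> c v) \<and>
    (\<forall>u \<in> {0..<n} \<times> {0..<n}. \<forall>v \<in> {0..<n} \<times> {0..<n}. u \<noteq> v \<longrightarrow>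
       torus_dist n u v + \<bar>int (c u) - int (c v)\<bar> \<ge> 1 + 2 * int (n div 2))"
  unfolding radio_labeling_def diam_torus[OF n]
  using graph_dist_torus[of _ n] by (simp add: pverts_torus Ball_def)

section \<open>Lower bound\<close>

text \<open>The range splits into \<open>j\<close> windows of length \<open>K\<close>; three
  elements in one window would contradict \<open>gap\<close>.\<close>

lemma card_initial_segment_le:
  fixes S :: "nat set"
  assumes fin: "finite S" and pos: "\<And>x. x \<in> S \<Longrightarrow> x \<ge> a"
    and gap: "\<And>x y z. x \<in> S \<Longrightarrow> y \<in> S \<Longrightarrow> z \<in> S \<Longrightarrow> x < y \<Longrightarrow> y < z \<Longrightarrow> x + K \<le> z"
  shows "card {x \<in> S. x < a + j * K} \<le> 2 * j"
proof (induction j)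
  case 0
  have "{x \<in> S. x < a} = {}" using pos by force
  then show ?case by simp
next
  case (Suc j)
  let ?W = "{x \<in> S. a + j * K \<le> x \<and> x < a + Suc j * K}"
  have "card ?W \<le> 2"
  proof (rule ccontr)
    assume "\<not> card ?W \<le> 2"
    then have "3 \<le> card ?W" by linarith
    from obtain_subset_with_card_n[OF this]
    obtain T where T: "T \<subseteq> ?W" "card T = 3" "finite T" by blast
    then obtain x y z where xyz: "x \<in> T" "y \<in> T" "z \<in> T" "x < y" "y < z"
    proof -
      let ?l = "sorted_list_of_set T"
      have l: "length ?l = 3" "set ?l = T" "sorted_wrt (<) ?l" using T by auto
      then have "?l ! 0 < ?l ! 1" "?l ! 1 < ?l ! 2" by (auto simp: sorted_wrt_iff_nth_less)
      moreover have "?l ! 0 \<in> T" "?l ! 1 \<in> T" "?l ! 2 \<in> T"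
        using l nth_mem[of _ ?l] by auto
      ultimately show ?thesis using that by blast
    qed
    then have "x + K \<le> z" using gap T by blast
    moreover have "a + j * K \<le> x" "z < a + Suc j * K" using xyz T by auto
    ultimately show False by simp
  qed
  moreover have "{x \<in> S. x < a + Suc j * K} \<subseteq> {x \<in> S. x < a + j * K} \<union> ?W" by auto
  then have "card {x \<in> S. x < a + Suc j * K} \<le> card ({x \<in> S. x < a + j * K} \<union> ?W)"
    using fin by (intro card_mono) auto
  moreover have "\<dots> \<le> card {x \<in> S. x < a + j * K} + card ?W" by (rule card_Un_le)
  ultimately show ?case using Suc by simp
qed

text \<open>The first \<open>j\<close> windows of length \<open>K\<close> hold at most
  \<open>2 * j\<close> of the \<open>n\<^sup>2\<close> distinct labels. The remaining
  \<open>1 + e\<close> labels start at \<open>1 + j * K\<close> at the earliest, so the largest is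
  at least \<open>1 + j * K + e\<close>.\<close>

lemma radio_labeling_span_ge:
  assumes n: "n > 0" and c: "radio_labeling (torus n) c"
    and K: "2 * K + 2 * n \<le> 6 * (n div 2) + 4"
    and N: "n\<^sup>2 = 2 * j + 1 + e" "e \<le> 1"
  shows "1 + j * K + e \<le> label_span (torus n) c"
proof -
  let ?V = "{0..<n} \<times> {0..<n}"
  let ?S = "c ` ?V"
  note c' = c[unfolded radio_labeling_torus_iff[OF n]]
  \<comment> \<open>Equal labels would require a distance beyond the diameter.\<close>
  have inj: "inj_on c ?V"
  proof (rule inj_onI, rule ccontr)
    fix u v assume uv: "u \<in> ?V" "v \<in> ?V" "c u = c v" "u \<noteq> v"
    then have "torus_dist n u v + \<bar>int (c u) - int (c v)\<bar> \<ge> 1 + 2 * int (n div 2)" using c' by blast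
    then show False using uv torus_dist_le[OF n, of u v] by simp
  qed
  have sep: "1 + 2 * int (n div 2) \<le> torus_dist n u v + (int (c v) - int (c u))"
    if "u \<in> ?V" "v \<in> ?V" "c u < c v" for u v
  proof -
    have "u \<noteq> v" using that by auto
    then have "torus_dist n u v + \<bar>int (c u) - int (c v)\<bar> \<ge> 1 + 2 * int (n div 2)"
      using c' that by blast
    moreover have "\<bar>int (c u) - int (c v)\<bar> = int (c v) - int (c u)" using that(3) by simp
    ultimately show ?thesis by simp
  qed
  have gap: "x + K \<le> z" if "x \<in> ?S" "y \<in> ?S" "z \<in> ?S" "x < y" "y < z" for x y z
  proof -
    obtain u where u: "u \<in> ?V" "x = c u" using \<open>x \<in> ?S\<close> by (rule imageE)
    obtain v where v: "v \<in> ?V" "y = c v" using \<open>y \<in> ?S\<close> by (rule imageE)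
    obtain w where w: "w \<in> ?V" "z = c w" using \<open>z \<in> ?S\<close> by (rule imageE)
    note * = u v w
    have "1 + 2 * int (n div 2) \<le> torus_dist n u v + (int y - int x)"
      "1 + 2 * int (n div 2) \<le> torus_dist n v w + (int z - int y)"
      "1 + 2 * int (n div 2) \<le> torus_dist n u w + (int z - int x)"
      using sep[of u v] sep[of v w] sep[of u w] * that(4,5) by simp_all
    moreover have "torus_dist n u v + torus_dist n v w + torus_dist n u w \<le> 2 * int n"
      using cyc_norm_triangle_sum[of n "int (fst u) - int (fst v)" "int (fst v) - int (fst w)"]
        cyc_norm_triangle_sum[of n "int (snd u) - int (snd v)" "int (snd v) - int (snd w)"] n
      unfolding torus_dist_def by simp
    ultimately have "3 * (1 + 2 * int (n div 2)) \<le> 2 * int n + 2 * (int z - int x)"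
      by simp
    moreover obtain m where "n div 2 = m" by simp
    ultimately have "3 * (1 + 2 * int m) \<le> 2 * int n + 2 * (int z - int x)"
      "2 * int K + 2 * int n \<le> 6 * int m + 4" using K by simp_all
    \<comment> \<open>The two inequalities give only \<open>2 * K - 1 \<le> 2 * (z - x)\<close>;
      integrality rounds this up to \<open>K\<close>. This is why the hypothesis on \<open>K\<close>
      has the constant 4 and not 3.\<close>
    then have "int x + int K \<le> int z" by simp
    then show ?thesis by simp
  qed
  have fin: "finite ?S" by simp
  have pos: "1 \<le> x" if "x \<in> ?S" for x using that c' by auto
  have "card {x \<in> ?S. x < 1 + j * K} \<le> 2 * j"
    by (rule card_initial_segment_le[OF fin pos gap])
  \<comment> \<open>For \<open>e = 1\<close> the range grows by one value, which accounts for at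
    most one more label.\<close>
  moreover have "{x \<in> ?S. x < 1 + j * K + e} \<subseteq> {x \<in> ?S. x < 1 + j * K} \<union> {x. x = j * K + 1 \<and> e = 1}"
    using N(2) by auto
  then have "card {x \<in> ?S. x < 1 + j * K + e}
      \<le> card ({x \<in> ?S. x < 1 + j * K} \<union> {x. x = j * K + 1 \<and> e = 1})"
    by (intro card_mono) auto
  moreover have "\<dots> \<le> card {x \<in> ?S. x < 1 + j * K} + card {x. x = j * K + 1 \<and> e = 1}"
    by (rule card_Un_le)
  moreover have "card {x. x = j * K + 1 \<and> e = 1} \<le> e" by (cases "e = 1") auto
  ultimately have lt: "card {x \<in> ?S. x < 1 + j * K + e} < card ?S"
    using N card_image[OF inj] by (simp add: power2_eq_square)
  have "\<exists>x \<in> ?S. 1 + j * K + e \<le> x"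
  proof (rule ccontr)
    assume "\<not> (\<exists>x \<in> ?S. 1 + j * K + e \<le> x)"
    then have "\<forall>x \<in> ?S. x < 1 + j * K + e" by (meson not_le)
    then have "{x \<in> ?S. x < 1 + j * K + e} = ?S" by blast
    with lt show False by simp
  qed
  then obtain x where "x \<in> ?S" "1 + j * K + e \<le> x" by blast
  moreover have "x \<le> Max ?S" using \<open>x \<in> ?S\<close> by (intro Max_ge) auto
  ultimately show ?thesis unfolding label_span_def pverts_torus by (meson le_trans)
qed

section \<open>Optimal labelings\<close>

text \<open>Read modulo \<open>n\<close>, the pairs \<open>(a i, b i)\<close> with
  \<open>i < n\<^sup>2\<close> are \<open>n\<^sup>2\<close> distinct vertices, hence all of them.
  Labelling the \<open>i\<close>-th by \<open>g i\<close> is then well defined, and by monotonicity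
  the last label is the span.\<close>

lemma radio_labeling_of_sequence:
  fixes a b :: "nat \<Rightarrow> int" and g :: "nat \<Rightarrow> nat"
  assumes n: "n > 0"
    and distinct: "\<And>i j. i < j \<Longrightarrow> j < n\<^sup>2 \<Longrightarrow> int n dvd a j - a i \<Longrightarrow> int n dvd b j - b i \<Longrightarrow> False"
    and pos: "\<And>i. 1 \<le> g i" and mono: "mono g"
    and sep: "\<And>i j. i < j \<Longrightarrow> j < n\<^sup>2 \<Longrightarrow>
      cyc_norm n (a j - a i) + cyc_norm n (b j - b i) + (int (g j) - int (g i)) \<ge> 1 + 2 * int (n div 2)"
  shows "\<exists>c. radio_labeling (torus n) c \<and> label_span (torus n) c = g (n\<^sup>2 - 1)"
proof -
  let ?V = "{0..<n} \<times> {0..<n}" and ?I = "{..<n\<^sup>2}"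
  define x where "x i = (nat (a i mod int n), nat (b i mod int n))" for i
  have xV: "x ` ?I \<subseteq> ?V" using n by (auto simp: x_def nat_less_iff)
  have inj: "inj_on x ?I"
  proof (rule linorder_inj_onI)
    fix i j :: nat assume "i < j" "j \<in> ?I"
    show "x i \<noteq> x j"
    proof
      assume "x i = x j"
      then have "a j mod int n = a i mod int n" "b j mod int n = b i mod int n"
        using n by (auto simp: x_def eq_nat_nat_iff)
      then have "int n dvd a j - a i" "int n dvd b j - b i" by (auto simp: mod_eq_dvd_iff)
      then show False using distinct \<open>i < j\<close> \<open>j \<in> ?I\<close> by auto
    qed
  qed auto
  have "x ` ?I = ?V"
    using xV card_image[OF inj] by (intro card_subset_eq) (auto simp: power2_eq_square)
  define c where "c v = g (inv_into ?I x v)" for v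
  have c: "c (x i) = g i" if "i < n\<^sup>2" for i
    using that inj by (simp add: c_def inv_into_f_f)
  have dist: "torus_dist n (x j) (x i) = cyc_norm n (a j - a i) + cyc_norm n (b j - b i)" for i j
    unfolding torus_dist_def x_def using n
    by (auto intro!: arg_cong2[where f = "(+)"] cyc_norm_cong simp: cong_def mod_diff_eq)
  have sym: "torus_dist n u v = torus_dist n v u" for u v
    unfolding torus_dist_def by (metis cyc_norm_minus minus_diff_eq)
  have sep': "torus_dist n (x j) (x i) + \<bar>int (c (x j)) - int (c (x i))\<bar> \<ge> 1 + 2 * int (n div 2)"
    if "i < j" "j < n\<^sup>2" for i j
    unfolding dist c[OF that(2)] c[OF less_trans[OF that]]
    by (rule order_trans[OF sep[OF that] add_left_mono[OF abs_ge_self]])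
  have "torus_dist n u v + \<bar>int (c u) - int (c v)\<bar> \<ge> 1 + 2 * int (n div 2)"
    if uv: "u \<in> ?V" "v \<in> ?V" "u \<noteq> v" for u v
  proof -
    have "u \<in> x ` ?I" "v \<in> x ` ?I" using uv \<open>x ` ?I = ?V\<close> by simp_all
    then obtain j i where ij: "u = x j" "v = x i" "i < n\<^sup>2" "j < n\<^sup>2" by blast
    then have "i \<noteq> j" using uv(3) by blast
    then consider "i < j" | "j < i" by (rule nat_neq_iff[THEN iffD1, THEN disjE])
    then show ?thesis
    proof cases
      case 1
      then show ?thesis unfolding ij(1,2) using ij(4) by (rule sep')
    next
      case 2
      then show ?thesis unfolding ij(1,2) sym[of "x j"] abs_minus_commute[of "int (c (x j))"]
        using ij(3) by (rule sep')
    qed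
  qed
  then have "radio_labeling (torus n) c"
    unfolding radio_labeling_torus_iff[OF n] using pos by (auto simp: c_def)
  moreover have "label_span (torus n) c = g (n\<^sup>2 - 1)"
    unfolding label_span_def pverts_torus
  proof (rule Max_eqI)
    fix y assume "y \<in> c ` ?V"
    then obtain i where "i < n\<^sup>2" "y = g i" using c unfolding \<open>x ` ?I = ?V\<close>[symmetric] by auto
    then show "y \<le> g (n\<^sup>2 - 1)" using monoD[OF mono, of i "n\<^sup>2 - 1"] by simp
  next
    have "n\<^sup>2 - 1 < n\<^sup>2" using n by simp
    then show "g (n\<^sup>2 - 1) \<in> c ` ?V"
      using c[of "n\<^sup>2 - 1"] unfolding \<open>x ` ?I = ?V\<close>[symmetric] by force
  qed simp
  ultimately show ?thesis by blast
qed

text \<open>Starts at 1 with increments alternating between \<open>r\<close> and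
  \<open>K - r\<close>, so that two positions always gain \<open>K\<close>, the least spread that
  the lower bound allows.\<close>

definition zigzag_label :: "nat \<Rightarrow> nat \<Rightarrow> nat \<Rightarrow> nat" where
  "zigzag_label K r i = 1 + (i div 2) * K + (i mod 2) * r"

lemma zigzag_label_pos: "1 \<le> zigzag_label K r i"
  by (simp add: zigzag_label_def)

lemma zigzag_label_even: "zigzag_label K r (2 * q) = 1 + q * K"
  and zigzag_label_odd: "zigzag_label K r (Suc (2 * q)) = 1 + q * K + r"
  by (simp_all add: zigzag_label_def)

lemma mono_zigzag_label:
  assumes "r \<le> K"
  shows "mono (zigzag_label K r)"
  unfolding mono_iff_le_Suc
proof
  fix i
  show "zigzag_label K r i \<le> zigzag_label K r (Suc i)"
  proof (cases "even i")
    case True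
    then obtain q where "i = 2 * q" by (elim evenE)
    then show ?thesis by (simp add: zigzag_label_even zigzag_label_odd)
  next
    case False
    then obtain q where "i = Suc (2 * q)" by (elim oddE) simp
    then show ?thesis
      using assms zigzag_label_even[of K r "Suc q"] zigzag_label_odd[of K r q] by simp
  qed
qed

section \<open>General constructions for even and odd order\<close>

text \<open>On an even cycle a point and its antipode lie on one geodesic from 0 to
  \<open>k\<close>, so their norms add up to \<open>k\<close>.\<close>

lemma cyc_norm_antipode:
  assumes k: "k > 0"
  shows "cyc_norm (2 * k) (x + k) = k - cyc_norm (2 * k) x"
    and "cyc_norm (2 * k) (x - k) = k - cyc_norm (2 * k) x"
proof -
  have k2: "2 * k > 0" using k by simp
  show plus: "cyc_norm (2 * k) (x + k) = k - cyc_norm (2 * k) x" for x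
  proof -
    obtain r q where 1: "x = r + 2 * k * q" "2 * \<bar>r\<bar> \<le> 2 * k" "cyc_norm (2 * k) x = \<bar>r\<bar>"
      using cyc_norm_repE[OF k2] .
    show ?thesis
    proof (cases "r \<ge> 0")
      case True
      have "x + k = (r - k) + 2 * k * (q + 1)" using 1 by (simp add: algebra_simps)
      then have "cyc_norm (2 * k) (x + k) = \<bar>r - k\<bar>"
        by (rule cyc_norm_eqI) (use 1 True k in auto)
      then show ?thesis using 1 True by simp
    next
      case False
      have "x + k = (r + k) + 2 * k * q" using 1 by simp
      then have "cyc_norm (2 * k) (x + k) = \<bar>r + k\<bar>"
        by (rule cyc_norm_eqI) (use 1 False k in auto)
      then show ?thesis using 1 False by simp
    qed
  qed
  show "cyc_norm (2 * k) (x - k) = k - cyc_norm (2 * k) x"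
    using plus[of "x - k"] by simp
qed

lemma int_dvd_abs_less_imp_eq_0:
  fixes d p :: int
  assumes "d dvd p" "\<bar>p\<bar> < d"
  shows "p = 0"
  using dvd_imp_le_int[of p d] assms by auto

text \<open>Here \<open>w\<close> is the carry: a shift by less than \<open>n\<close> crosses at
  most one multiple of \<open>n\<close>. It controls the turn counters of both
  constructions.\<close>

lemma div_add_less_cases:
  fixes i :: nat
  assumes "c < n"
  obtains w where "w \<le> 1" "(i + c) div n = i div n + w"
proof -
  have "i div n \<le> (i + c) div n" by (simp add: div_le_mono)
  moreover have "(i + c) div n \<le> (i + n) div n" using assms by (intro div_le_mono) simp
  moreover have "(i + n) div n = i div n + 1" using assms by simp
  ultimately show ?thesis using that[of "(i + c) div n - i div n"] by simp
qed

text \<open>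
  The vertices at positions \<open>2 * u\<close> and \<open>2 * u + 1\<close> are antipodal, and the vertices at positions
  \<open>2 * u\<close> and \<open>2 * u + 2\<close> are at distance \<open>k\<close> or \<open>k - 1\<close>. In the coordinates \<open>(a - b, b)\<close> of the
  quotient by \<open>(k, k)\<close>, a step that changes \<open>a - b\<close> by \<open>k\<close> or \<open>k + 1\<close> has a representative of
  such a length, whatever it does to \<open>b\<close>; so alternating these two changes reaches everything.
\<close>

lemma radio_labeling_even:
  assumes k: "k > 0" and n: "n = 2 * k"
  shows "\<exists>c. radio_labeling (torus n) c \<and>
    label_span (torus n) c = zigzag_label (k + 2) 1 (n\<^sup>2 - 1)"
proof -
  define t e f :: "nat \<Rightarrow> int" where "t i = int (i div 4)" and "e i = int (i div 2 mod 2)"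
    and "f i = int (i mod 2)" for i
  \<comment> \<open>\<open>f\<close> switches to the antipode. Since
    \<open>a - b = t div k + k * e\<close> and \<open>b = t mod k + k * (t div k + f)\<close>, the
    residues modulo \<open>n\<close> recover \<open>t\<close>, \<open>e\<close> and \<open>f\<close>
    when \<open>t < k * k\<close>.\<close>
  define a b :: "nat \<Rightarrow> int" where "a i = t i + t i div k + k * e i + k * f i"
    and "b i = t i + k * f i" for i
  have k': "int k > 0" using k by simp
  have decomp: "int i = 4 * t i + 2 * e i + f i" for i
  proof -
    have "i = (i div 2 div 2 * 2 + i div 2 mod 2) * 2 + i mod 2" by (simp only: div_mult_mod_eq)
    moreover have "i div 2 div 2 = i div 4" by (simp add: div_mult2_eq[symmetric])
    ultimately have "i = (i div 4 * 2 + i div 2 mod 2) * 2 + i mod 2" by (simp only:)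
    from arg_cong[OF this, of int]
    have "int i = (int (i div 4) * 2 + int (i div 2 mod 2)) * 2 + int (i mod 2)"
      by (simp only: of_nat_add of_nat_mult of_nat_numeral)
    also have "\<dots> = 4 * t i + 2 * e i + f i" unfolding t_def e_def f_def by simp
    finally show ?thesis .
  qed
  have ef: "0 \<le> e i" "e i \<le> 1" "0 \<le> f i" "f i \<le> 1" "0 \<le> t i" for i
    by (auto simp: t_def e_def f_def)
  have div_less: "i div 4 < k * k" if "i < n\<^sup>2" for i
    using that n by (simp add: power2_eq_square div_less_iff_less_mult mult.commute)
  show ?thesis
  proof (rule radio_labeling_of_sequence[where a = a and b = b])
    show "n > 0" using k n by simp
    show "1 \<le> zigzag_label (k + 2) 1 i" for i by (rule zigzag_label_pos)
    show "mono (zigzag_label (k + 2) 1)" by (rule mono_zigzag_label) simp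
  next
    fix i j assume ij: "i < j" "j < n\<^sup>2" and da: "int n dvd a j - a i" and db: "int n dvd b j - b i"
    \<comment> \<open>Modulo \<open>k\<close> the antipodal shift vanishes and \<open>b\<close>
      retains only \<open>t mod k\<close>.\<close>
    have "int k dvd b j - b i" using db n by (metis dvd_mult_left mult.commute of_nat_mult)
    then have "int k dvd t j - t i + int k * (f j - f i)" unfolding b_def by (simp add: algebra_simps)
    then have "int k dvd t j - t i" using dvd_add_left_iff[of "int k" "int k * (f j - f i)" "t j - t i"] by simp
    then have "t j mod k = t i mod k" by (simp add: mod_eq_dvd_iff)
    moreover have "t x = k * (t x div k) + t x mod k" for x by simp
    ultimately have tt: "t j - t i = k * (t j div k - t i div k)" by (metis add_diff_cancel_right right_diff_distrib')
    define p where "p = t j div k - t i div k"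
    have "b j - b i = k * (p + (f j - f i))" using tt by (simp add: b_def p_def algebra_simps)
    \<comment> \<open>Cancelling \<open>k\<close> from \<open>n = 2 * k\<close> leaves a parity,
      which separates the values of \<open>f\<close> once \<open>p = 0\<close>.\<close>
    then have 2: "2 dvd p + (f j - f i)" using db k' n by simp
    have eqa: "a j - a i = k * (p + (f j - f i) + (e j - e i)) + p" using tt by (simp add: a_def p_def algebra_simps)
    moreover have "int k dvd a j - a i" using da n by (metis dvd_mult_left mult.commute of_nat_mult)
    ultimately have kp: "int k dvd p" using dvd_add_right_iff[of "int k" "k * (p + (f j - f i) + (e j - e i))" p] by simp
    have q: "0 \<le> t x div k" "t x div k < int k" if "x < n\<^sup>2" for x
    proof -
      show "0 \<le> t x div k" using ef(5) k' by (simp add: pos_imp_zdiv_nonneg_iff)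
      show "t x div k < int k"
        unfolding t_def zdiv_int[symmetric] of_nat_less_iff
        by (rule less_mult_imp_div_less[OF div_less[OF that]])
    qed
    have "\<bar>p\<bar> < int k" using q[of i] q[of j] ij unfolding p_def by auto
    with kp have "p = 0" by (rule int_dvd_abs_less_imp_eq_0)
    then have "t j = t i" using tt by (simp add: p_def)
    moreover have "f j = f i"
    proof -
      have "2 dvd f j - f i" using 2 \<open>p = 0\<close> by simp
      then show ?thesis using ef(3,4)[of i] ef(3,4)[of j] by presburger
    qed
    moreover have "e j = e i"
    proof -
      have "a j - a i = k * (e j - e i)" using eqa \<open>p = 0\<close> \<open>f j = f i\<close> by simp
      then have "2 dvd e j - e i" using da k' n by simp
      then show ?thesis using ef(1,2)[of i] ef(1,2)[of j] by presburger
    qed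
    ultimately show False using decomp[of i] decomp[of j] ij by simp
  next
    fix i j assume ij: "i < j" "j < n\<^sup>2"
    define u v where "u = i div 2" and "v = j div 2"
    have uv: "e i = int (u mod 2)" "e j = int (v mod 2)" "t i = int (u div 2)" "t j = int (v div 2)"
      unfolding u_def v_def e_def t_def by (simp_all add: div_mult2_eq[symmetric])
    let ?d = "f j - f i"
    have nn: "int n > 0" "int n = 2 * int k" "int (n div 2) = int k" using k n by auto
    have g: "int (zigzag_label (k + 2) 1 x) = 1 + int (x div 2) * (int k + 2) + f x" for x
      by (simp add: zigzag_label_def f_def algebra_simps)
    have gap: "int (zigzag_label (k + 2) 1 j) - int (zigzag_label (k + 2) 1 i)
        = (int v - int u) * (int k + 2) + ?d"
      unfolding g u_def v_def by (simp add: algebra_simps)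
    \<comment> \<open>If \<open>f\<close> differs, both coordinates are shifted by \<open>k\<close>,
      and the sum of the two norms becomes \<open>2 * k\<close> minus itself.\<close>
    have antipode: "cyc_norm n (x + k * ?d) = (if ?d = 0 then cyc_norm n x else k - cyc_norm n x)" for x
    proof -
      have "?d = 0 \<or> ?d = 1 \<or> ?d = -1" using ef(3,4)[of i] ef(3,4)[of j] by linarith
      then show ?thesis using cyc_norm_antipode[OF k', of x] nn(2) by auto
    qed
    have "u \<le> v" using ij unfolding u_def v_def by (simp add: div_le_mono)
    then consider "v = u" | "v = u + 1" | "v \<ge> u + 2" by linarith
    then show "1 + 2 * int (n div 2) \<le> cyc_norm n (a j - a i) + cyc_norm n (b j - b i)
        + (int (zigzag_label (k + 2) 1 j) - int (zigzag_label (k + 2) 1 i))"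
    proof cases
      case 1
      have "e i = e j" "t i = t j" using 1 uv by simp_all
      moreover have "f i = 0 \<and> f j = 1"
        using calculation decomp[of i] decomp[of j] ij ef(3,4)[of i] ef(3,4)[of j] by auto
      ultimately have "a j - a i = k" "b j - b i = k" "?d = 1" by (simp_all add: a_def b_def)
      then show ?thesis using gap 1 nn by (simp add: cyc_norm_small)
    next
      case 2
      \<comment> \<open>\<open>w1\<close> and \<open>w2\<close> are the displacements without the
        antipodal shift. The lower bound on their norms settles \<open>?d = 0\<close>; the upper one
        settles \<open>?d = -1\<close>, where the label gap is only \<open>k + 1\<close>.\<close>
      obtain w1 w2 where w: "a j - a i = w1 + k * ?d" "b j - b i = w2 + k * ?d"
        "int k - 1 \<le> cyc_norm n w1 + cyc_norm n w2" "cyc_norm n w1 + cyc_norm n w2 \<le> k"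
      proof (cases "e i = 0")
        case True
        then have "e j = 1" "t j = t i" using 2 unfolding uv by presburger+
        then show ?thesis using True nn
          by (intro that[of k 0]) (simp_all add: a_def b_def algebra_simps cyc_norm_small)
      next
        case False
        then have e: "e i = 1" "e j = 0" and t: "t j = t i + 1" using 2 unfolding uv by presburger+
        then have "j div 4 = i div 4 + 1" by (simp add: t_def)
        \<comment> \<open>For \<open>k = 1\<close> only \<open>t = 0\<close> occurs, so
          \<open>t\<close> cannot advance. From \<open>k \<ge> 2\<close> on,
          \<open>1 + w \<le> k\<close> fixes the sign in the next norm.\<close>
        have "k > 1"
        proof (rule ccontr)
          assume "\<not> k > 1"
          then have "k = 1" using k by simp
          then show False using div_less[OF ij(2)] t ef(5)[of i] by (simp add: t_def)
        qed
        with div_add_less_cases[of 1 k "i div 4"] obtain w where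
          w: "w \<le> 1" "(i div 4 + 1) div k = i div 4 div k + w" by blast
        then have dv: "t j div k = t i div k + int w"
          unfolding t_def \<open>j div 4 = i div 4 + 1\<close> zdiv_int[symmetric] w(2) by simp
        \<comment> \<open>Together with the norm 1 of the other coordinate this gives
          \<open>k - w\<close>, that is \<open>k\<close> or \<open>k - 1\<close>.\<close>
        have "cyc_norm n (1 + int w - k) = k - (1 + int w)"
          using w(1) \<open>k > 1\<close> nn by (subst cyc_norm_small) auto
        moreover have "cyc_norm n 1 = 1" using nn \<open>k > 1\<close> by (subst cyc_norm_small) auto
        moreover have "a j - a i = (1 + int w - k) + k * ?d" "b j - b i = 1 + k * ?d"
          using dv e t by (simp_all add: a_def b_def algebra_simps)
        ultimately show ?thesis using that w(1) by simp
      qed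
      have "\<bar>?d\<bar> \<le> 1" using ef(3,4)[of i] ef(3,4)[of j] by linarith
      moreover have "int v - int u = 1" using 2 by simp
      then have "int (zigzag_label (k + 2) 1 j) - int (zigzag_label (k + 2) 1 i) = int k + 2 + ?d"
        unfolding gap by simp
      ultimately show ?thesis using w(3,4) unfolding w(1,2) antipode nn(3) by (simp add: abs_le_iff)
    next
      case 3
      have "2 * (int k + 2) \<le> (int v - int u) * (int k + 2)" using 3 by (intro mult_right_mono) auto
      moreover have "?d \<ge> -1" using ef(3,4)[of i] ef(3,4)[of j] by linarith
      ultimately show ?thesis
        using cyc_norm_nonneg[OF nn(1), of "a j - a i"] cyc_norm_nonneg[OF nn(1), of "b j - b i"]
        unfolding gap nn(3) by simp
    qed
  qed
qed

text \<open>
  The sequence has constant step \<open>s = (k, k div 2 + 1)\<close>, with the extra step \<open>t = (- 1, 1)\<close> after each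
  of the \<open>n\<close> turns around the cyclic group of \<open>s\<close>; it visits every vertex because
  \<open>det (s, t) = k + k div 2 + 1\<close> is a unit modulo \<open>n\<close>. For \<open>k = 1\<close> and \<open>k = 2\<close> the step \<open>s + t\<close>
  is too short.
\<close>

lemma radio_labeling_odd:
  assumes k: "k \<ge> 3" and n: "n = 2 * k + 1"
  shows "\<exists>c. radio_labeling (torus n) c \<and>
    label_span (torus n) c = zigzag_label (k + 1) ((k + 1) div 2) (n\<^sup>2 - 1)"
proof -
  \<comment> \<open>One step \<open>s\<close> has length \<open>k + h + 1\<close>, so a label gap of
    \<open>r = k - h\<close> meets the bound \<open>2 * k + 1\<close> exactly; the alternate gap
    \<open>k + 1 - r = h + 1\<close> is at least \<open>r\<close>.\<close>
  define h r where "h = k div 2" and "r = (k + 1) div 2"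
  have hr: "h + r = k" "r \<le> h + 1" "h \<le> r" unfolding h_def r_def by presburger+
  then have hr': "int h + int r = int k" by linarith
  define a b :: "nat \<Rightarrow> int" where "a i = i * int k - i div n" and "b i = i * (int h + 1) + i div n" for i
  let ?g = "zigzag_label (k + 1) r"
  have nn: "int n > 0" "int n = 2 * int k + 1" "int (n div 2) = int k" using n by auto
  have "\<exists>c. radio_labeling (torus n) c \<and> label_span (torus n) c = ?g (n\<^sup>2 - 1)"
  proof (rule radio_labeling_of_sequence[where a = a and b = b])
    show "n > 0" using n by simp
    show "1 \<le> ?g i" for i by (rule zigzag_label_pos)
    show "mono ?g" by (rule mono_zigzag_label) (use hr in simp)
  next
    fix i j assume ij: "i < j" "j < n\<^sup>2" and da: "int n dvd a j - a i" and db: "int n dvd b j - b i"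
    define I J where "I = int j - int i" and "J = int (j div n) - int (i div n)"
    have "a j - a i = I * k - J" "b j - b i = I * (int h + 1) + J"
      by (simp_all add: a_def b_def I_def J_def algebra_simps)
    then have d: "int n dvd I * k - J" "int n dvd I * (int h + 1) + J" using da db by simp_all
    have "int n dvd I"
    proof -
      \<comment> \<open>Adding the coordinates eliminates \<open>J\<close>. The factor of
        \<open>I\<close> is a unit because four times it is \<open>3 * n + 1\<close> or
        \<open>3 * n - 1\<close>, according to the parity of \<open>k\<close>.\<close>
      have "int n dvd (I * k - J) + (I * (int h + 1) + J)" using d by (rule dvd_add)
      then have s: "int n dvd I * (int k + int h + 1)" by (simp add: algebra_simps)
      have "k = 2 * h \<or> k = 2 * h + 1" unfolding h_def by presburger
      then have "4 * (int k + int h + 1) = 3 * int n + 1 \<or> 4 * (int k + int h + 1) = 3 * int n - 1"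
        using nn(2) by auto
      then have pm: "4 * (int k + int h + 1) - 3 * int n = 1 \<or> 4 * (int k + int h + 1) - 3 * int n = - 1"
        by auto
      have "int n dvd 4 * (I * (int k + int h + 1)) - 3 * I * int n"
        using s by (intro dvd_diff) auto
      also have "\<dots> = I * (4 * (int k + int h + 1) - 3 * int n)" by (simp add: algebra_simps)
      finally have d': "int n dvd I * (4 * (int k + int h + 1) - 3 * int n)" .
      from pm show ?thesis
      proof
        assume "4 * (int k + int h + 1) - 3 * int n = 1"
        with d' show ?thesis by (simp only: mult_1_right)
      next
        assume "4 * (int k + int h + 1) - 3 * int n = - 1"
        with d' show ?thesis by (simp only: mult_minus1_right dvd_minus_iff)
      qed
    qed
    then have "int n dvd I * int k" by simp
    then have "int n dvd J" using d(1) by (simp add: dvd_diff_right_iff)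
    have "i div n < n" "j div n < n" using ij n
      by (auto simp: div_less_iff_less_mult power2_eq_square)
    then have "\<bar>J\<bar> < int n" unfolding J_def by linarith
    with \<open>int n dvd J\<close> have "J = 0" by (rule int_dvd_abs_less_imp_eq_0)
    then have "j div n = i div n" by (simp add: J_def)
    moreover have "int j mod n = int i mod n" using \<open>int n dvd I\<close> by (simp add: I_def mod_eq_dvd_iff)
    then have "j mod n = i mod n" by (metis of_nat_eq_iff zmod_int)
    ultimately have "j = i" by (metis div_mult_mod_eq)
    then show False using ij by simp
  next
    fix i j assume ij: "i < j" "j < n\<^sup>2"
    have nonneg: "0 \<le> cyc_norm n x" for x by (rule cyc_norm_nonneg[OF nn(1)])
    have step2: "int (?g (i + 2)) = int (?g i) + int k + 1" for i
      by (simp add: zigzag_label_def algebra_simps)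
    have step1: "int (?g i) + int r \<le> int (?g (i + 1))" for i
    proof (cases "even i")
      case True
      then obtain q where "i = 2 * q" by (elim evenE)
      then show ?thesis by (simp add: zigzag_label_even zigzag_label_odd)
    next
      case False
      then obtain q where "i = Suc (2 * q)" by (elim oddE) simp
      then show ?thesis
        using hr zigzag_label_even[of "k + 1" r "Suc q"] zigzag_label_odd[of "k + 1" r q] by simp
    qed
    have mono: "mono ?g" by (rule mono_zigzag_label) (use hr in simp)
    consider "j = i + 1" | "j = i + 2" | "j = i + 3" | "j \<ge> i + 4" using ij by linarith
    then show "1 + 2 * int (n div 2) \<le> cyc_norm n (a j - a i) + cyc_norm n (b j - b i)
        + (int (?g j) - int (?g i))"
    proof cases
      case 1
      obtain w where w: "w \<le> 1" "j div n = i div n + w"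
        using div_add_less_cases[of 1 n i] k n 1 by auto
      have "a j - a i = k - int w" "b j - b i = int h + 1 + int w"
        using w 1 by (simp_all add: a_def b_def algebra_simps)
      \<comment> \<open>The extra step \<open>t\<close> only moves one unit of length from the first
        coordinate to the second. With \<open>w = 1\<close> the second norm needs
        \<open>h + 2 \<le> k\<close>, which \<open>k \<ge> 3\<close> provides.\<close>
      moreover have "cyc_norm n (k - int w) = k - int w"
        using w(1) k nn by (subst cyc_norm_small) auto
      moreover have "cyc_norm n (int h + 1 + int w) = int h + 1 + int w"
        using w(1) k nn h_def by (subst cyc_norm_small) auto
      ultimately show ?thesis using step1[of i] 1 hr' nn(3) by simp
    next
      case 2
      obtain w where w: "w \<le> 1" "j div n = i div n + w"
        using div_add_less_cases[of 2 n i] k n 2 by auto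
      have ab: "a j - a i = 2 * k - int w" "b j - b i = 2 * int h + 2 + int w"
        using w 2 by (simp_all add: a_def b_def algebra_simps)
      \<comment> \<open>Again \<open>w\<close> cancels: the two norms add up to
        \<open>2 * k - 2 * h \<ge> k\<close>, and the label gap is \<open>k + 1\<close>.\<close>
      have "cyc_norm n (2 * k - int w) = \<bar>- 1 - int w\<bar>"
        using w(1) k nn by (intro cyc_norm_eqI[of _ _ _ 1]) auto
      moreover have "cyc_norm n (2 * int h + 2 + int w) = \<bar>2 * int h + 1 + int w - 2 * int k\<bar>"
        using w(1) k nn hr by (intro cyc_norm_eqI[of _ _ _ 1]) auto
      ultimately show ?thesis using step2[of i] 2 hr hr' nn(3) w(1) k unfolding ab by simp
    next
      case 3
      obtain w where w: "w \<le> 1" "j div n = i div n + w"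
        using div_add_less_cases[of 3 n i] k n 3 by auto
      have "a j - a i = 3 * k - int w"
        using w 3 by (simp_all add: a_def algebra_simps)
      moreover have "cyc_norm n (3 * k - int w) = \<bar>int k - 1 - int w\<bar>"
        using w(1) k nn by (intro cyc_norm_eqI[of _ _ _ 1]) auto
      \<comment> \<open>The first coordinate alone suffices: its norm \<open>k - 1 - w\<close> is at
        least \<open>h\<close>, and the label gap is at least \<open>k + 1 + r\<close>.\<close>
      moreover have "h + 2 \<le> k" using k unfolding h_def by presburger
      then have "int h + 2 \<le> int k" "int w \<le> 1" using w(1) by simp_all
      ultimately have "int h \<le> cyc_norm n (a j - a i)" by simp
      moreover have "int (?g i) + int k + 1 + int r \<le> int (?g j)"
        using step1[of "i + 2"] step2[of i] 3 by (simp add: numeral_3_eq_3)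
      ultimately show ?thesis using hr' nonneg[of "b j - b i"] unfolding nn(3) by simp
    next
      case 4
      have "?g (i + 4) \<le> ?g j" using mono 4 by (rule monoD)
      moreover have "int (?g (i + 4)) = int (?g i) + 2 * int k + 2"
        using step2[of i] step2[of "i + 2"] by (simp add: numeral_eq_Suc)
      ultimately show ?thesis
        using nn(3) nonneg[of "a j - a i"] nonneg[of "b j - b i"] by linarith
    qed
  qed
  then show ?thesis by (simp only: r_def)
qed

section \<open>Orders 1, 3 and 5\<close>

text \<open>Turns the conditions on a sequence into a finite check by evaluation. Distinctness
  modulo \<open>n\<close> appears as a nonzero sum of norms.\<close>

lemma radio_labeling_of_list:
  assumes n: "n > 0" and r: "r \<le> K"
    and chk: "list_all (\<lambda>j. list_all (\<lambda>i.
        let da = cyc_norm (int n) (fst (xs ! j) - fst (xs ! i));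
            db = cyc_norm (int n) (snd (xs ! j) - snd (xs ! i))
        in da + db \<noteq> 0 \<and>
           da + db + (int (zigzag_label K r j) - int (zigzag_label K r i)) \<ge> 1 + 2 * int (n div 2))
        [0..<j]) [0..<n\<^sup>2]"
  shows "\<exists>c. radio_labeling (torus n) c \<and> label_span (torus n) c = zigzag_label K r (n\<^sup>2 - 1)"
proof (rule radio_labeling_of_sequence[where a = "\<lambda>i. fst (xs ! i)" and b = "\<lambda>i. snd (xs ! i)"])
  show "1 \<le> zigzag_label K r i" for i by (rule zigzag_label_pos)
  show "mono (zigzag_label K r)" using r by (rule mono_zigzag_label)
next
  fix i j assume ij: "i < j" "j < n\<^sup>2"
  then have *: "cyc_norm n (fst (xs ! j) - fst (xs ! i)) + cyc_norm n (snd (xs ! j) - snd (xs ! i)) \<noteq> 0"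
    "cyc_norm n (fst (xs ! j) - fst (xs ! i)) + cyc_norm n (snd (xs ! j) - snd (xs ! i))
      + (int (zigzag_label K r j) - int (zigzag_label K r i)) \<ge> 1 + 2 * int (n div 2)"
    using chk by (auto simp: list_all_iff Let_def)
  show "cyc_norm n (fst (xs ! j) - fst (xs ! i)) + cyc_norm n (snd (xs ! j) - snd (xs ! i))
      + (int (zigzag_label K r j) - int (zigzag_label K r i)) \<ge> 1 + 2 * int (n div 2)"
    by (rule *)
  assume "int n dvd fst (xs ! j) - fst (xs ! i)" "int n dvd snd (xs ! j) - snd (xs ! i)"
  then have "cyc_norm n (fst (xs ! j) - fst (xs ! i)) = 0" "cyc_norm n (snd (xs ! j) - snd (xs ! i)) = 0"
    using n by (simp_all add: cyc_norm_eq_0_iff)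
  then show False using *(1) by simp
qed (use n in simp)

lemma radio_labeling_three:
  "\<exists>c. radio_labeling (torus 3) c \<and> label_span (torus 3) c = zigzag_label 2 1 (3\<^sup>2 - 1)"
  \<comment> \<open>The list runs through the three cosets of the diagonal by steps
    \<open>(1, 1)\<close>.\<close>
  by (rule radio_labeling_of_list[where xs = "[(0, 0), (1, 1), (2, 2), (0, 1), (1, 2), (2, 0), (0, 2), (1, 0), (2, 1)]"]; code_simp)

lemma radio_labeling_five:
  "\<exists>c. radio_labeling (torus 5) c \<and> label_span (torus 5) c = zigzag_label 3 1 (5\<^sup>2 - 1)"
  \<comment> \<open>With gaps alternating 1 and 2, consecutive vertices must be at distance 4 and at
    least 3 in turn, and vertices two positions apart at distance at least 2.\<close>
  by (rule radio_labeling_of_list[where xs = "[(0, 0), (2, 2), (0, 3), (2, 0), (0, 1),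
    (2, 3), (0, 4), (3, 1), (0, 2), (3, 4), (1, 0), (3, 2), (1, 3), (3, 0), (4, 2), (2, 4),
    (1, 2), (4, 0), (2, 1), (4, 3), (1, 4), (4, 1), (3, 3), (1, 1), (4, 4)]"]; code_simp)

lemma radio_labeling_one:
  "\<exists>c. radio_labeling (torus 1) c \<and> label_span (torus 1) c = zigzag_label 1 0 (1\<^sup>2 - 1)"
  by (rule radio_labeling_of_sequence[where a = "\<lambda>_. 0" and b = "\<lambda>_. 0"])
    (simp_all add: zigzag_label_def mono_zigzag_label)

section \<open>The radio numbers\<close>

lemma radio_numberI:
  assumes n: "n > 0" and K: "2 * K + 2 * n \<le> 6 * (n div 2) + 4"
    and N: "n\<^sup>2 = 2 * j + 1 + e" "e \<le> 1"
    and c: "\<exists>c. radio_labeling (torus n) c \<and> label_span (torus n) c = 1 + j * K + e"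
  shows "radio_number (torus n) = 1 + j * K + e"
  unfolding radio_number_def
  by (rule Least_equality) (use c radio_labeling_span_ge[OF n _ K N] in auto)

lemma radio_number_even:
  assumes "k > 0" "n = 2 * k"
  shows "radio_number (torus n) = (2 * k\<^sup>2 - 1) * (k + 2) + 2"
proof -
  have "k\<^sup>2 > 0" using assms by simp
  then obtain m where m: "k\<^sup>2 = Suc m" by (cases "k\<^sup>2") auto
  \<comment> \<open>For even \<open>n\<close> two labels remain after the full windows, so
    \<open>e = 1\<close>, and the last position \<open>n\<^sup>2 - 1\<close> is odd.\<close>
  have N: "n\<^sup>2 = 2 * (2 * k\<^sup>2 - 1) + 1 + 1" using assms m by (simp add: power_mult_distrib)
  have "radio_number (torus n) = 1 + (2 * k\<^sup>2 - 1) * (k + 2) + 1"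
  proof (rule radio_numberI[OF _ _ N])
    have "zigzag_label (k + 2) 1 (n\<^sup>2 - 1) = 1 + (2 * k\<^sup>2 - 1) * (k + 2) + 1"
      using zigzag_label_odd[of "k + 2" 1 "2 * k\<^sup>2 - 1"] N by simp
    then show "\<exists>c. radio_labeling (torus n) c \<and> label_span (torus n) c = 1 + (2 * k\<^sup>2 - 1) * (k + 2) + 1"
      using radio_labeling_even[OF assms] by simp
  qed (use assms in auto)
  then show ?thesis by simp
qed

lemma radio_number_odd:
  assumes n: "n = 2 * k + 1"
  shows "radio_number (torus n) = 2 * k * (k + 1) * (k + 1) + 1"
proof -
  have N: "n\<^sup>2 = 2 * (2 * k * (k + 1)) + 1 + 0" using n by (simp add: power2_eq_square algebra_simps)
  have "radio_number (torus n) = 1 + (2 * k * (k + 1)) * (k + 1) + 0"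
  proof (rule radio_numberI[OF _ _ N])
    \<comment> \<open>For odd \<open>n\<close> the last position is even, so the span is the same
      for every \<open>r\<close> and each case may choose its own.\<close>
    have label: "zigzag_label (k + 1) r (n\<^sup>2 - 1) = 1 + (2 * k * (k + 1)) * (k + 1) + 0" for r
      using zigzag_label_even[of "k + 1" r "2 * k * (k + 1)"] N by simp
    have "\<exists>c. radio_labeling (torus n) c \<and> (\<exists>r. label_span (torus n) c = zigzag_label (k + 1) r (n\<^sup>2 - 1))"
    proof -
      consider "k = 0" | "k = 1" | "k = 2" | "k \<ge> 3" by linarith
      then show ?thesis
      proof cases
        case 1
        then have "n = 1" "k + 1 = 1" using n by auto
        then show ?thesis using radio_labeling_one by metis
      next
        case 2
        then have "n = 3" "k + 1 = 2" using n by auto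
        then show ?thesis using radio_labeling_three by metis
      next
        case 3
        then have "n = 5" "k + 1 = 3" using n by auto
        then show ?thesis using radio_labeling_five by metis
      next
        case 4
        then show ?thesis using radio_labeling_odd[OF 4 n] by blast
      qed
    qed
    then show "\<exists>c. radio_labeling (torus n) c \<and>
        label_span (torus n) c = 1 + (2 * k * (k + 1)) * (k + 1) + 0"
      unfolding label by blast
  qed (use n in auto)
  then show ?thesis by simp
qed

theorem mainTheorem1:
  fixes n k :: nat
  assumes "n > 0"
  shows "(n = 2 * k \<longrightarrow>
            real (radio_number (cartesian_product (cycle_graph n) (cycle_graph n)))
              = ((real n)\<^sup>2 - 2) / 2 * (real k + 2) + 2) \<and>
         (n = 2 * k + 1 \<longrightarrow>
            real (radio_number (cartesian_product (cycle_graph n) (cycle_graph n)))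
              = ((real n)\<^sup>2 - 1) / 2 * (real k + 1) + 1)"
proof (intro conjI impI)
  assume n: "n = 2 * k"
  then have k: "k > 0" using assms by simp
  \<comment> \<open>Makes the truncated subtraction in \<open>2 * k\<^sup>2 - 1\<close> agree with
    the real one.\<close>
  then have "1 \<le> 2 * k\<^sup>2" using zero_less_power[of k 2] by linarith
  then have "real (2 * k\<^sup>2 - 1) = 2 * (real k)\<^sup>2 - 1" by (simp add: of_nat_diff)
  then have "real (radio_number (torus n)) = (2 * (real k)\<^sup>2 - 1) * (real k + 2) + 2"
    unfolding radio_number_even[OF k n] by (simp only: of_nat_add of_nat_mult of_nat_numeral)
  also have "\<dots> = ((real n)\<^sup>2 - 2) / 2 * (real k + 2) + 2"
    using n by (simp add: power_mult_distrib field_simps)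
  finally show "real (radio_number (torus n)) = ((real n)\<^sup>2 - 2) / 2 * (real k + 2) + 2" .
next
  assume n: "n = 2 * k + 1"
  show "real (radio_number (torus n)) = ((real n)\<^sup>2 - 1) / 2 * (real k + 1) + 1"
    unfolding radio_number_odd[OF n] using n by (simp add: power2_eq_square algebra_simps)
qed

end
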